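(* Assume (A1) the vectors $Y_1,Y_2,\dots$ are i.i.d. in $\mathbb{R}^K$ and $Y_i$ is independent of $\mathcal{F}_{i-1}$ for every $i\ge 1$; (A3) $\mathbb{E}[\max_{1\le k\le K}|Y_{1,k}|]<\infty$. Let $k^*\in\arg\max_k\mu_k$ be a true best model and let $\hat k_n\in\arg\max_k\bar S_{n,k}$ be the (random) selected model. Then for every $n\ge 1$: (a) $$\mathbb{E}\Bigl[\max_{1\le k\le K}\bar S_{n,k}\Bigr]=n\mu_{k^*}+\sum_{i=1}^n\mathbb{E}\bigl[\phi_{K,\Delta}(R_{i-1})\bigr],$$ equivalently, $$\mathbb{E}\Bigl[\max_{1\le k\le K}R_{n,k}\Bigr]=\sum_{i=1}^n\mathbb{E}\bigl[\phi_{K,\Delta}(R_{i-1})\bigr].$$ (b) $$\mathbb{E}\Bigl[\frac{\bar S_{n,\hat k_n}}{n}-\mu_{\hat k_n}\Bigr]=\frac1n\,\mathbb{E}\bigl[S_{n,\hat k_n}\bigr]\ge 0.$$ (c) $$0\le\mathbb{E}\Bigl[\max_{1\le k\le K}R_{n,k}\Bigr]\le\mathbb{E}\Bigl[\max_{1\le k\le K}S_{n,k}\Bigr].$$ (d) If $k^*$ is unique (that is, $\arg\max_k\mu_k$ is a singleton), then $$\frac1n\,\mathbb{E}\Bigl[\max_{1\le k\le K}R_{n,k}\Bigr]\to 0\quad\text{as } n\to\infty.$$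
   Context: Fix an integer $K\ge 1$ and a probability space $(\Omega,\mathcal{F},P)$. Let $X_1,X_2,\dots$ be i.i.d. random elements of a measurable space $\mathcal{X}$ (with generic copy $X$), and for $k\in\{1,\dots,K\}$ let $f_k:\mathcal{X}\to\mathbb{R}$ be measurable with (finite) mean $\mu_k=\mathbb{E}[f_k(X)]$; the means $\mu_1,\dots,\mu_K$ may differ. Put $Y_{i,k}=f_k(X_i)-\mu_k$ (centered increments), $Y_i=(Y_{i,1},\dots,Y_{i,K})\in\mathbb{R}^K$ (coordinates may be dependent), and $S_{n,k}=\sum_{i=1}^nY_{i,k}$, with $S_{0,k}=0$. The filtration is $\mathcal{F}_n=\sigma(X_1,\dots,X_n)$, with $\mathcal{F}_0=\{\emptyset,\Omega\}$. The uncentered cumulative scores are $\bar S_{n,k}=\sum_{i=1}^nf_k(X_i)=n\mu_k+S_{n,k}$. The selected index $\hat k_n$ is a random variable with values in $\{1,\dots,K\}$ satisfying $\hat k_n\in\arg\max_k\bar S_{n,k}$ (ties broken in any measurable way). The gaps are $\Delta_k=\mu_{k^*}-\mu_k\ge 0$, so $\Delta_{k^*}=0$, and $\Delta=(\Delta_1,\dots,\Delta_K)$. The drifted walks are $R_{n,k}=S_{n,k}-n\Delta_k$, $R_n=(R_{n,1},\dots,R_{n,K})$, with $R_0=(0,\dots,0)$. The heterogeneous selection premium is, for $u\in\mathbb{R}^K$, $$\phi_{K,\Delta}(u)=\mathbb{E}\Bigl[\max_{1\le k\le K}(u_k+Y_k-\Delta_k)\Bigr]-\max_{1\le k\le K}u_k,$$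 where $Y=(Y_1,\dots,Y_K)$ inside this formula denotes a random vector with the same distribution as the increment vector $(Y_{1,1},\dots,Y_{1,K})$. *)

theory Defs
  imports "HOL-Probability.Probability"
begin

text \<open>
  The model indices form the finite type \<open>'k\<close>, so \<open>K = CARD('k) \<ge> 1\<close> and \<open>\<real>\<^sup>K\<close> is \<open>real ^ 'k\<close>.
  Random sequences are indexed by \<open>i \<ge> 1\<close>; their value at \<open>0\<close> is never constrained or used.
\<close>

definition iid_seq :: "'a measure \<Rightarrow> 'b measure \<Rightarrow> (nat \<Rightarrow> 'a \<Rightarrow> 'b) \<Rightarrow> bool" where
  "iid_seq M N X \<longleftrightarrow>
     prob_space.indep_vars M (\<lambda>_. N) X {1..} \<and> (\<forall>i\<ge>1. distr M N (X i) = distr M N (X 1))"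

definition rv_indep_of_alg :: "'a measure \<Rightarrow> 'b measure \<Rightarrow> ('a \<Rightarrow> 'b) \<Rightarrow> 'a set set \<Rightarrow> bool" where
  "rv_indep_of_alg M N Z F \<longleftrightarrow>
     Z \<in> measurable M N \<and> prob_space.indep_set M {Z -` B \<inter> space M | B. B \<in> sets N} F"

text \<open>The \<open>\<sigma>\<close>-algebra generated by \<open>X 1, \<dots>, X n\<close>; for \<open>n = 0\<close> it is \<open>{{}, space M}\<close>.\<close>

definition past_alg :: "'a measure \<Rightarrow> 'x measure \<Rightarrow> (nat \<Rightarrow> 'a \<Rightarrow> 'x) \<Rightarrow> nat \<Rightarrow> 'a set set" where
  "past_alg M N X n =
     sigma_sets (space M) (\<Union>i\<in>{1..n}. {X i -` A \<inter> space M | A. A \<in> sets N})"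

definition max_coord :: "real ^ 'k \<Rightarrow> real" where
  "max_coord u = (MAX k. u $ k)"

text \<open>The generic copy of the data is taken to be \<open>X 1\<close>.\<close>

definition score_mean ::
    "'a measure \<Rightarrow> (nat \<Rightarrow> 'a \<Rightarrow> 'x) \<Rightarrow> ('k \<Rightarrow> 'x \<Rightarrow> real) \<Rightarrow> 'k \<Rightarrow> real" where
  "score_mean M X f k = (\<integral>\<omega>. f k (X 1 \<omega>) \<partial>M)"

definition centered_incr ::
    "'a measure \<Rightarrow> (nat \<Rightarrow> 'a \<Rightarrow> 'x) \<Rightarrow> ('k \<Rightarrow> 'x \<Rightarrow> real) \<Rightarrow> nat \<Rightarrow> 'a \<Rightarrow> real ^ 'k" where
  "centered_incr M X f i \<omega> = (\<chi> k. f k (X i \<omega>) - score_mean M X f k)"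

definition centered_walk ::
    "'a measure \<Rightarrow> (nat \<Rightarrow> 'a \<Rightarrow> 'x) \<Rightarrow> ('k \<Rightarrow> 'x \<Rightarrow> real) \<Rightarrow> nat \<Rightarrow> 'a \<Rightarrow> real ^ 'k" where
  "centered_walk M X f n \<omega> = (\<Sum>i=1..n. centered_incr M X f i \<omega>)"

definition cum_score ::
    "(nat \<Rightarrow> 'a \<Rightarrow> 'x) \<Rightarrow> ('k \<Rightarrow> 'x \<Rightarrow> real) \<Rightarrow> nat \<Rightarrow> 'a \<Rightarrow> real ^ 'k" where
  "cum_score X f n \<omega> = (\<chi> k. \<Sum>i=1..n. f k (X i \<omega>))"

definition gap ::
    "'a measure \<Rightarrow> (nat \<Rightarrow> 'a \<Rightarrow> 'x) \<Rightarrow> ('k \<Rightarrow> 'x \<Rightarrow> real) \<Rightarrow> 'k \<Rightarrow> real ^ 'k" where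
  "gap M X f kstar = (\<chi> k. score_mean M X f kstar - score_mean M X f k)"

definition drifted_walk ::
    "'a measure \<Rightarrow> (nat \<Rightarrow> 'a \<Rightarrow> 'x) \<Rightarrow> ('k \<Rightarrow> 'x \<Rightarrow> real) \<Rightarrow> 'k \<Rightarrow> nat \<Rightarrow> 'a \<Rightarrow> real ^ 'k" where
  "drifted_walk M X f kstar n \<omega> = centered_walk M X f n \<omega> - real n *\<^sub>R gap M X f kstar"

definition incr_law ::
    "'a measure \<Rightarrow> (nat \<Rightarrow> 'a \<Rightarrow> 'x) \<Rightarrow> ('k \<Rightarrow> 'x \<Rightarrow> real) \<Rightarrow> (real ^ 'k) measure" where
  "incr_law M X f = distr M borel (centered_incr M X f 1)"

text \<open>
  The heterogeneous selection premium \<open>\<phi>\<close>, with \<open>\<nu>\<close> the law of the increment vector and \<open>\<Delta>\<close> the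
  vector of gaps. Integrating over \<open>\<nu>\<close> keeps the \<open>Y\<close> of the formula separate from the argument
  \<open>u\<close>, which is later replaced by a random vector on the original probability space.
\<close>

definition selection_premium ::
    "(real ^ 'k) measure \<Rightarrow> real ^ 'k \<Rightarrow> real ^ 'k \<Rightarrow> real" where
  "selection_premium \<nu> \<Delta> u = (\<integral>y. max_coord (u + y - \<Delta>) \<partial>\<nu>) - max_coord u"

end

theory Submission
  imports Defs
begin

text \<open>
  One step of the drifted walk, \<open>R\<^sub>n = R\<^sub>n\<^sub>-\<^sub>1 + Y\<^sub>n - \<Delta>\<close> with \<open>Y\<^sub>n\<close> independent of \<open>R\<^sub>n\<^sub>-\<^sub>1\<close>, raises the expected
  maximum by the expected premium (Fubini), so (a) telescopes; the uncentered maximum is the maximum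
  of \<open>R\<^sub>n\<close> shifted by \<open>n\<close> times the best mean. Since \<open>\<Delta> \<ge> 0\<close>, the score of the selected index satisfies
  \<open>S\<^sub>n \<ge> max R\<^sub>n\<close>, and \<open>max R\<^sub>n\<close> dominates the \<open>k\<^sup>*\<close>-coordinate of \<open>S\<^sub>n\<close>, which has mean zero; this gives
  (b) and (c). For (d), \<open>max R\<^sub>n\<close> is at most the sum of the \<open>\<bar>S\<^sub>n\<^sub>,\<^sub>k\<bar>\<close>, and each
  \<open>E\<bar>S\<^sub>n\<^sub>,\<^sub>k\<bar> / n\<close> tends to zero by the weak law of large numbers in \<open>L\<^sup>1\<close>, proved by truncation.
\<close>

section \<open>Sums of independent random variables\<close>

context prob_space
begin

text \<open>Disjoint blocks of an independent family are independent, and so are measurable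
  functions of them: here the sum over one block and the single remaining variable. It serves to
  separate the past of the walk from its next increment.\<close>

lemma indep_var_sum_euclidean:
  fixes X :: "'i \<Rightarrow> 'a \<Rightarrow> 'b::euclidean_space"
  assumes "finite I" "i \<notin> I" and indep: "indep_vars (\<lambda>_. borel) X (insert i I)"
  shows "indep_var borel (\<lambda>\<omega>. \<Sum>j\<in>I. X j \<omega>) borel (X i)"
proof -
  have "indep_var (PiM I (\<lambda>_. borel)) (\<lambda>\<omega>. restrict (\<lambda>j. X j \<omega>) I)
          (PiM {i} (\<lambda>_. borel)) (\<lambda>\<omega>. restrict (\<lambda>j. X j \<omega>) {i})"
    using assms by (intro indep_var_restrict[OF indep]) auto
  then have "indep_var borel ((\<lambda>x. \<Sum>j\<in>I. x j) \<circ> (\<lambda>\<omega>. restrict (\<lambda>j. X j \<omega>) I))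
          borel ((\<lambda>x. x i) \<circ> (\<lambda>\<omega>. restrict (\<lambda>j. X j \<omega>) {i}))"
    by (rule indep_var_compose) auto
  then show ?thesis
    by (simp add: comp_def)
qed

text \<open>Independence factors the expectation of each cross term, and the centering makes it
  vanish. Integrability is carried through the same induction, because expanding the square of the
  longer sum requires it.\<close>

lemma indep_vars_second_moment_sum:
  fixes W :: "'i \<Rightarrow> 'a \<Rightarrow> real"
  assumes "finite I" and "indep_vars (\<lambda>_. borel) W I"
    and "\<And>i. i \<in> I \<Longrightarrow> integrable M (\<lambda>\<omega>. (W i \<omega>)\<^sup>2)"
    and "\<And>i. i \<in> I \<Longrightarrow> expectation (W i) = 0"
  shows "integrable M (\<lambda>\<omega>. (\<Sum>i\<in>I. W i \<omega>)\<^sup>2) \<and>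
         expectation (\<lambda>\<omega>. (\<Sum>i\<in>I. W i \<omega>)\<^sup>2) = (\<Sum>i\<in>I. expectation (\<lambda>\<omega>. (W i \<omega>)\<^sup>2))"
  using assms
proof (induction I rule: finite_induct)
  case empty
  then show ?case by simp
next
  case (insert i I)
  let ?T = "\<lambda>\<omega>. \<Sum>j\<in>I. W j \<omega>"
  have meas: "W j \<in> borel_measurable M" if "j \<in> insert i I" for j
    using insert.prems(1) that by (auto simp: indep_vars_def)
  have int: "integrable M (W j)" if "j \<in> insert i I" for j
    by (rule square_integrable_imp_integrable[OF meas insert.prems(2)]) (rule that)+
  have "indep_vars (\<lambda>_. borel) W I"
    by (rule indep_vars_subset[OF insert.prems(1)]) auto
  from insert.IH[OF this insert.prems(2,3)]
  have IH: "integrable M (\<lambda>\<omega>. (?T \<omega>)\<^sup>2)"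
    "expectation (\<lambda>\<omega>. (?T \<omega>)\<^sup>2) = (\<Sum>j\<in>I. expectation (\<lambda>\<omega>. (W j \<omega>)\<^sup>2))"
    by simp_all
  have ind: "indep_var borel (W i) borel ?T"
    by (rule indep_vars_sum[OF insert.hyps insert.prems(1)])
  have intT: "integrable M ?T"
    by (intro Bochner_Integration.integrable_sum int) simp
  have cross: "integrable M (\<lambda>\<omega>. W i \<omega> * ?T \<omega>)" "expectation (\<lambda>\<omega>. W i \<omega> * ?T \<omega>) = 0"
    using indep_var_integrable[OF ind int intT] indep_var_lebesgue_integral[OF ind int intT]
      insert.prems(3) by auto
  have eq: "(\<Sum>j\<in>insert i I. W j \<omega>)\<^sup>2 = (W i \<omega>)\<^sup>2 + 2 * (W i \<omega> * ?T \<omega>) + (?T \<omega>)\<^sup>2" for \<omega>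
    using insert.hyps by (simp add: power2_sum)
  have "integrable M (\<lambda>\<omega>. (W i \<omega>)\<^sup>2)"
    using insert.prems by auto
  then show ?case
    unfolding eq using IH cross insert.hyps by simp
qed

text \<open>Cutting the summands at a fixed level \<open>c\<close> leaves bounded variables, whose centered sum is controlled
  through its variance, and an error that is small in \<open>L\<^sup>1\<close> by dominated convergence.\<close>

lemma L1_weak_law_of_large_numbers:
  fixes Z :: "nat \<Rightarrow> 'a \<Rightarrow> real"
  assumes indep: "indep_vars (\<lambda>_. borel) Z {1..}"
    and ident: "\<And>i. i \<ge> 1 \<Longrightarrow> distr M borel (Z i) = distr M borel (Z 1)"
    and int: "integrable M (Z 1)" and mean: "expectation (Z 1) = 0"
  shows "(\<lambda>n. expectation (\<lambda>\<omega>. \<bar>\<Sum>i=1..n. Z i \<omega>\<bar>) / real n) \<longlonglongrightarrow> 0"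
proof -
  \<comment> \<open>Large values are sent to 0 and not to the level, so that
    \<open>x - cut c x\<close> is either \<open>0\<close> or \<open>x\<close>. Hence
    \<open>\<bar>Z 1 \<omega>\<bar>\<close> dominates the truncation error at every level.\<close>
  define cut :: "real \<Rightarrow> real \<Rightarrow> real" where "cut c x = (if \<bar>x\<bar> \<le> c then x else 0)" for c x
  have cut_meas [measurable]: "cut c \<in> borel_measurable borel" for c
    unfolding cut_def by measurable
  have cut_bound: "\<bar>cut c x\<bar> \<le> c" if "c \<ge> 0" for c x
    using that by (simp add: cut_def)
  have Z_meas [measurable]: "Z i \<in> borel_measurable M" if "i \<ge> 1" for i
    using indep that by (auto simp: indep_vars_def)
  have Z1_meas [measurable]: "Z 1 \<in> borel_measurable M"
    by (rule Z_meas) simp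
  \<comment> \<open>Both integrals depend only on the law, so every estimate for \<open>Z 1\<close>
    holds uniformly in \<open>i\<close>.\<close>
  have transfer_int: "integrable M (\<lambda>\<omega>. g (Z i \<omega>)) \<longleftrightarrow> integrable M (\<lambda>\<omega>. g (Z 1 \<omega>))"
    and transfer_exp: "expectation (\<lambda>\<omega>. g (Z i \<omega>)) = expectation (\<lambda>\<omega>. g (Z 1 \<omega>))"
    if "i \<ge> 1" and g: "g \<in> borel_measurable borel" for i and g :: "real \<Rightarrow> real"
    using integrable_distr_eq[OF Z_meas g] integrable_distr_eq[OF Z1_meas g]
      integral_distr[OF Z_meas g] integral_distr[OF Z1_meas g] ident that(1) by metis+
  have Z_int: "integrable M (Z i)" if "i \<ge> 1" for i
    using transfer_int[OF that, of "\<lambda>x. x"] int by simp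
  have tail: "(\<lambda>m::nat. expectation (\<lambda>\<omega>. \<bar>Z 1 \<omega> - cut (real m) (Z 1 \<omega>)\<bar>)) \<longlonglongrightarrow> expectation (\<lambda>\<omega>. 0)"
  proof (rule integral_dominated_convergence)
    show "integrable M (\<lambda>\<omega>. \<bar>Z 1 \<omega>\<bar>)" using int by simp
    show "AE \<omega> in M. (\<lambda>m. \<bar>Z 1 \<omega> - cut (real m) (Z 1 \<omega>)\<bar>) \<longlonglongrightarrow> 0"
    proof (rule AE_I2)
      fix \<omega>
      have "eventually (\<lambda>m. \<bar>Z 1 \<omega>\<bar> \<le> real m) sequentially"
        using eventually_ge_at_top[of "nat \<lceil>\<bar>Z 1 \<omega>\<bar>\<rceil>"] by eventually_elim linarith
      then have "eventually (\<lambda>m. \<bar>Z 1 \<omega> - cut (real m) (Z 1 \<omega>)\<bar> = 0) sequentially"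
        by eventually_elim (simp add: cut_def)
      then show "(\<lambda>m. \<bar>Z 1 \<omega> - cut (real m) (Z 1 \<omega>)\<bar>) \<longlonglongrightarrow> 0"
        by (rule tendsto_eventually)
    qed
    show "AE \<omega> in M. norm \<bar>Z 1 \<omega> - cut (real m) (Z 1 \<omega>)\<bar> \<le> \<bar>Z 1 \<omega>\<bar>" for m
      by (auto simp: cut_def)
  qed auto
  show ?thesis
  proof (rule LIMSEQ_I)
    fix r :: real assume "r > 0"
    \<comment> \<open>The bound \<open>main\<close> contributes three times \<open>e\<close> and its
      last term less than one more, once \<open>n\<close> is large; the total stays below
      \<open>r\<close>.\<close>
    define e where "e = r / 5"
    have e: "e > 0" using \<open>r > 0\<close> by (simp add: e_def)
    from LIMSEQ_D[OF tail e] obtain m :: nat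
      where m: "expectation (\<lambda>\<omega>. \<bar>Z 1 \<omega> - cut (real m) (Z 1 \<omega>)\<bar>) < e" by fastforce
    define c where "c = real m"
    have c: "c \<ge> 0" by (simp add: c_def)
    \<comment> \<open>\<open>Z i\<close> is split as \<open>W i\<close>, plus the truncation error,
      plus the constant \<open>a\<close>: a bounded centered part, a part small in mean, and a small
      bias.\<close>
    define a where "a = expectation (\<lambda>\<omega>. cut c (Z 1 \<omega>))"
    define W where "W i \<omega> = cut c (Z i \<omega>) - a" for i \<omega>
    define V where "V i \<omega> = \<bar>Z i \<omega> - cut c (Z i \<omega>)\<bar>" for i \<omega>
    have cut_int: "integrable M (\<lambda>\<omega>. cut c (Z i \<omega>))" if "i \<ge> 1" for i
      using that cut_bound[OF c] by (intro integrable_const_bound[of _ c]) auto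
    have V_int: "integrable M (V i)" if "i \<ge> 1" for i
      using Z_int[OF that] cut_int[OF that] unfolding V_def by auto
    have V_exp: "expectation (V i) \<le> e" if "i \<ge> 1" for i
      using transfer_exp[OF that, of "\<lambda>x. \<bar>x - cut c x\<bar>"] m unfolding V_def c_def by simp
    have abs_a: "\<bar>a\<bar> \<le> c"
    proof -
      have "\<bar>a\<bar> \<le> expectation (\<lambda>\<omega>. \<bar>cut c (Z 1 \<omega>)\<bar>)"
        unfolding a_def by (rule integral_abs_bound)
      also have "\<dots> \<le> expectation (\<lambda>_. c)"
        using cut_int[of 1] cut_bound[OF c] by (intro integral_mono) auto
      finally show ?thesis by (simp add: prob_space)
    qed
    have a_le: "\<bar>a\<bar> \<le> e"
    proof -
      \<comment> \<open>As \<open>Z 1\<close> has mean zero, the mean lost by truncating equals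
        \<open>- a\<close>, so the bias is no larger than the expected truncation error.\<close>
      have "- a = expectation (\<lambda>\<omega>. Z 1 \<omega> - cut c (Z 1 \<omega>))"
        using int cut_int[of 1] mean by (simp add: a_def)
      then have "\<bar>a\<bar> = \<bar>expectation (\<lambda>\<omega>. Z 1 \<omega> - cut c (Z 1 \<omega>))\<bar>"
        by linarith
      also have "\<dots> \<le> expectation (V 1)"
        unfolding V_def by (rule integral_abs_bound)
      finally show ?thesis using V_exp[of 1] by simp
    qed
    have W_sq: "(W i \<omega>)\<^sup>2 \<le> (2 * c)\<^sup>2" for i \<omega>
      using cut_bound[OF c, of "Z i \<omega>"] abs_a c unfolding W_def
      by (intro power2_le_iff_abs_le[THEN iffD2]) auto
    have W_meas: "W i \<in> borel_measurable M" if "i \<ge> 1" for i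
      using that unfolding W_def by measurable
    have W_sq_int: "integrable M (\<lambda>\<omega>. (W i \<omega>)\<^sup>2)" if "i \<ge> 1" for i
      using W_meas[OF that] W_sq by (intro integrable_const_bound[of _ "(2 * c)\<^sup>2"]) auto
    have W_sq_exp: "expectation (\<lambda>\<omega>. (W i \<omega>)\<^sup>2) \<le> (2 * c)\<^sup>2" if "i \<ge> 1" for i
    proof -
      have "expectation (\<lambda>\<omega>. (W i \<omega>)\<^sup>2) \<le> expectation (\<lambda>_. (2 * c)\<^sup>2)"
        using W_sq_int[OF that] W_sq by (intro integral_mono) auto
      then show ?thesis by (simp add: prob_space)
    qed
    have W_mean: "expectation (W i) = 0" if "i \<ge> 1" for i
      using transfer_exp[OF that cut_meas] cut_int[OF that]
      unfolding W_def by (simp add: a_def prob_space)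
    have W_indep: "indep_vars (\<lambda>_. borel) W {1..}"
      unfolding W_def by (rule indep_vars_compose2[OF indep]) simp
    have main: "expectation (\<lambda>\<omega>. \<bar>\<Sum>i=1..n. Z i \<omega>\<bar>) / real n \<le> 3 * e + (2 * c)\<^sup>2 / e / real n"
      if n: "n \<ge> 1" for n
    proof -
      let ?T = "\<lambda>\<omega>. \<Sum>i=1..n. W i \<omega>"
      have sm: "integrable M (\<lambda>\<omega>. (?T \<omega>)\<^sup>2)"
        "expectation (\<lambda>\<omega>. (?T \<omega>)\<^sup>2) = (\<Sum>i=1..n. expectation (\<lambda>\<omega>. (W i \<omega>)\<^sup>2))"
        using indep_vars_second_moment_sum[of "{1..n}" W] indep_vars_subset[OF W_indep, of "{1..n}"]
          W_sq_int W_mean by auto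
      have sm_le: "expectation (\<lambda>\<omega>. (?T \<omega>)\<^sup>2) \<le> real n * (2 * c)\<^sup>2"
        using sum_bounded_above[of "{1..n}" "\<lambda>i. expectation (\<lambda>\<omega>. (W i \<omega>)\<^sup>2)" "(2 * c)\<^sup>2"]
          W_sq_exp unfolding sm(2) by auto
      let ?B = "\<lambda>\<omega>. real n * e + (?T \<omega>)\<^sup>2 / (real n * e) + (\<Sum>i=1..n. V i \<omega>) + real n * \<bar>a\<bar>"
      have ne: "real n * e > 0" using n e by simp
      have pt: "\<bar>\<Sum>i=1..n. Z i \<omega>\<bar> \<le> ?B \<omega>" for \<omega>
      proof -
        \<comment> \<open>This elementary inequality passes from the first moment of
          \<open>?T\<close> to its second. With \<open>d = real n * e\<close>, the second moment, at
          most \<open>real n * (2 * c)\<^sup>2\<close>, contributes only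
          \<open>(2 * c)\<^sup>2 / e\<close>, which vanishes after division by
          \<open>n\<close>.\<close>
        have "\<bar>t\<bar> \<le> d + t\<^sup>2 / d" if "d > 0" for t d :: real
        proof (cases "\<bar>t\<bar> \<le> d")
          case True
          then show ?thesis using that by (simp add: add_increasing2)
        next
          case False
          then have "\<bar>t\<bar> * d \<le> \<bar>t\<bar> * \<bar>t\<bar>" by (intro mult_left_mono) auto
          then have "\<bar>t\<bar> \<le> t\<^sup>2 / d"
            using that by (simp add: pos_le_divide_eq power2_eq_square)
          then show ?thesis using that by simp
        qed
        from this[OF ne, of "?T \<omega>"] have 1: "\<bar>?T \<omega>\<bar> \<le> real n * e + (?T \<omega>)\<^sup>2 / (real n * e)" .
        have "(\<Sum>i=1..n. Z i \<omega>) = (\<Sum>i=1..n. W i \<omega> + (Z i \<omega> - cut c (Z i \<omega>)) + a)"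
          by (simp add: W_def)
        also have "\<dots> = ?T \<omega> + (\<Sum>i=1..n. Z i \<omega> - cut c (Z i \<omega>)) + real n * a"
          by (simp add: sum.distrib)
        finally have "\<bar>\<Sum>i=1..n. Z i \<omega>\<bar>
            \<le> \<bar>?T \<omega>\<bar> + \<bar>\<Sum>i=1..n. Z i \<omega> - cut c (Z i \<omega>)\<bar> + \<bar>real n * a\<bar>"
          by linarith
        moreover have "\<bar>\<Sum>i=1..n. Z i \<omega> - cut c (Z i \<omega>)\<bar> \<le> (\<Sum>i=1..n. V i \<omega>)"
          unfolding V_def by (rule sum_abs)
        ultimately show ?thesis using 1 by (simp add: abs_mult)
      qed
      have "expectation (\<lambda>\<omega>. \<bar>\<Sum>i=1..n. Z i \<omega>\<bar>) \<le> expectation ?B"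
        using sm(1) V_int Z_int pt
        by (intro integral_mono integrable_abs Bochner_Integration.integrable_sum
            Bochner_Integration.integrable_add integrable_divide) auto
      also have "\<dots> = real n * e + expectation (\<lambda>\<omega>. (?T \<omega>)\<^sup>2) / (real n * e)
          + (\<Sum>i=1..n. expectation (V i)) + real n * \<bar>a\<bar>"
      proof -
        have 1: "integrable M (\<lambda>\<omega>. (?T \<omega>)\<^sup>2 / (real n * e))"
          using sm(1) by (rule integrable_divide_zero)
        have 2: "integrable M (\<lambda>\<omega>. \<Sum>i=1..n. V i \<omega>)"
          "expectation (\<lambda>\<omega>. \<Sum>i=1..n. V i \<omega>) = (\<Sum>i=1..n. expectation (V i))"
          using V_int by (intro Bochner_Integration.integrable_sum Bochner_Integration.integral_sum; simp)+
        have "expectation (\<lambda>\<omega>. p + A \<omega> + B \<omega> + q) = p + expectation A + expectation B + q"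
          if "integrable M A" "integrable M B" for p q :: real and A B
          using that by (simp add: prob_space)
        from this[OF 1 2(1)] show ?thesis
          unfolding 2(2) integral_divide_zero .
      qed
      \<comment> \<open>The three copies of \<open>real n * e\<close> come from the threshold
        \<open>d\<close>, the truncation errors and the bias, in this order.\<close>
      also have "\<dots> \<le> real n * e + real n * (2 * c)\<^sup>2 / (real n * e) + real n * e + real n * e"
        using sm_le ne V_exp a_le sum_bounded_above[of "{1..n}" "\<lambda>i. expectation (V i)" e]
        by (intro add_mono divide_right_mono mult_left_mono) auto
      also have "\<dots> = real n * (3 * e + (2 * c)\<^sup>2 / e / real n)"
        using n e by (simp add: field_simps)
      finally show ?thesis using n by (simp add: divide_le_eq mult.commute)
    qed
    have "(\<lambda>n. (2 * c)\<^sup>2 / e / real n) \<longlonglongrightarrow> 0"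
      by (rule lim_const_over_n)
    from LIMSEQ_D[OF this e] obtain n0
      where n0: "\<And>n. n \<ge> n0 \<Longrightarrow> (2 * c)\<^sup>2 / e / real n < e"
      by (metis abs_less_iff diff_zero real_norm_def)
    show "\<exists>n0. \<forall>n\<ge>n0. norm (expectation (\<lambda>\<omega>. \<bar>\<Sum>i=1..n. Z i \<omega>\<bar>) / real n - 0) < r"
    proof (intro exI allI impI)
      fix n assume "n \<ge> max 1 n0"
      then show "norm (expectation (\<lambda>\<omega>. \<bar>\<Sum>i=1..n. Z i \<omega>\<bar>) / real n - 0) < r"
        using main[of n] n0[of n] e by (simp add: e_def)
    qed
  qed
qed

text \<open>By independence the joint law is the product of the marginal laws, so Fubini applies on
  the product space. Only \<open>Y\<close> is integrated out against its law; the outer integral is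
  pulled back to \<open>M\<close>, which is the shape of the expected premium.\<close>

lemma indep_var_fubini:
  fixes g :: "'b \<times> 'b \<Rightarrow> 'd::{banach, second_countable_topology}"
  assumes indep: "indep_var N1 U N2 Y" and g: "g \<in> borel_measurable (N1 \<Otimes>\<^sub>M N2)"
    and int: "integrable M (\<lambda>\<omega>. g (U \<omega>, Y \<omega>))"
  shows "integrable M (\<lambda>\<omega>. \<integral>y. g (U \<omega>, y) \<partial>distr M N2 Y)"
    and "expectation (\<lambda>\<omega>. g (U \<omega>, Y \<omega>)) = expectation (\<lambda>\<omega>. \<integral>y. g (U \<omega>, y) \<partial>distr M N2 Y)"
proof -
  have [measurable]: "U \<in> measurable M N1" "Y \<in> measurable M N2"
    using indep by (auto dest: indep_var_rv1 indep_var_rv2)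
  note g [measurable]
  interpret PU: prob_space "distr M N1 U" by (rule prob_space_distr) simp
  interpret PY: prob_space "distr M N2 Y" by (rule prob_space_distr) simp
  interpret P: pair_prob_space "distr M N1 U" "distr M N2 Y" ..
  have joint: "distr M N1 U \<Otimes>\<^sub>M distr M N2 Y = distr M (N1 \<Otimes>\<^sub>M N2) (\<lambda>\<omega>. (U \<omega>, Y \<omega>))"
    using indep by (simp add: indep_var_distribution_eq)
  have int_joint: "integrable (distr M N1 U \<Otimes>\<^sub>M distr M N2 Y) g"
    unfolding joint using int by (subst integrable_distr_eq) auto
  have inner: "(\<lambda>u. \<integral>y. g (u, y) \<partial>distr M N2 Y) \<in> borel_measurable N1"
    by measurable
  show "integrable M (\<lambda>\<omega>. \<integral>y. g (U \<omega>, y) \<partial>distr M N2 Y)"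
    using P.integrable_fst'[OF int_joint] inner by (subst (asm) integrable_distr_eq) auto
  have "expectation (\<lambda>\<omega>. g (U \<omega>, Y \<omega>)) = integral\<^sup>L (distr M N1 U \<Otimes>\<^sub>M distr M N2 Y) g"
    unfolding joint by (subst integral_distr) auto
  also have "\<dots> = (\<integral>u. \<integral>y. g (u, y) \<partial>distr M N2 Y \<partial>distr M N1 U)"
    using P.integral_fst'[OF int_joint] by simp
  also have "\<dots> = expectation (\<lambda>\<omega>. \<integral>y. g (U \<omega>, y) \<partial>distr M N2 Y)"
    using inner by (subst integral_distr) auto
  finally show "expectation (\<lambda>\<omega>. g (U \<omega>, Y \<omega>)) = \<dots>" .
qed

end

section \<open>The largest coordinate\<close>

lemma coord_le_max_coord: "(u :: real ^ 'k::finite) $ k \<le> max_coord u"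
  unfolding max_coord_def by (rule Max_ge) auto

lemma max_coord_le_iff: "max_coord (u :: real ^ 'k::finite) \<le> c \<longleftrightarrow> (\<forall>k. u $ k \<le> c)"
  unfolding max_coord_def by (subst Max_le_iff) auto

lemma max_coord_zero: "max_coord (0 :: real ^ 'k::finite) = 0"
  by (simp add: max_coord_def)

lemma max_coord_mono:
  fixes u v :: "real ^ 'k::finite"
  assumes "\<And>k. u $ k \<le> v $ k"
  shows "max_coord u \<le> max_coord v"
  unfolding max_coord_le_iff using assms coord_le_max_coord order_trans by blast

lemma max_coord_eqI:
  fixes u :: "real ^ 'k::finite"
  assumes "\<And>j. u $ j \<le> u $ k"
  shows "max_coord u = u $ k"
  using assms by (intro antisym coord_le_max_coord) (simp add: max_coord_le_iff)

lemma max_coord_attained: "\<exists>k. max_coord (u :: real ^ 'k::finite) = u $ k"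
proof -
  have "max_coord u \<in> range (\<lambda>k. u $ k)"
    unfolding max_coord_def by (rule Max_in) auto
  then show ?thesis by auto
qed

lemma max_coord_add_const:
  "max_coord (\<chi> k. (u :: real ^ 'k::finite) $ k + c) = max_coord u + c"
proof -
  obtain k where "max_coord u = u $ k"
    using max_coord_attained by blast
  moreover have "max_coord (\<chi> k. u $ k + c) = (\<chi> k. u $ k + c) $ k"
    using coord_le_max_coord[of u] calculation by (intro max_coord_eqI) simp
  ultimately show ?thesis by simp
qed

lemma abs_coord_le_sum: "\<bar>(u :: real ^ 'k::finite) $ k\<bar> \<le> (\<Sum>j\<in>UNIV. \<bar>u $ j\<bar>)"
  by (rule member_le_sum) auto

lemma abs_max_coord_le: "\<bar>max_coord (u :: real ^ 'k::finite)\<bar> \<le> (\<Sum>k\<in>UNIV. \<bar>u $ k\<bar>)"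
  by (metis abs_coord_le_sum max_coord_attained)

lemma borel_measurable_max_coord [measurable]:
  "max_coord \<in> borel_measurable (borel :: (real ^ 'k::finite) measure)"
  unfolding max_coord_def by measurable

text \<open>The sum of the absolute coordinates dominates the maximum, so integrability can be
  checked one coordinate at a time.\<close>

lemma integrable_max_coord:
  fixes V :: "'a \<Rightarrow> real ^ 'k::finite"
  assumes int: "\<And>k. integrable M (\<lambda>\<omega>. V \<omega> $ k)"
  shows "integrable M (\<lambda>\<omega>. max_coord (V \<omega>))"
proof (rule Bochner_Integration.integrable_bound)
  show "integrable M (\<lambda>\<omega>. \<Sum>k\<in>UNIV. \<bar>V \<omega> $ k\<bar>)"
    using int by auto
  have [measurable]: "(\<lambda>\<omega>. V \<omega> $ k) \<in> borel_measurable M" for k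
    using int by auto
  show "(\<lambda>\<omega>. max_coord (V \<omega>)) \<in> borel_measurable M"
    unfolding max_coord_def by measurable
qed (use abs_max_coord_le in \<open>auto intro: order_trans[OF _ abs_ge_self]\<close>)

section \<open>The drifted walk\<close>

locale score_walk = prob_space M
  for M :: "'a measure" +
  fixes X :: "nat \<Rightarrow> 'a \<Rightarrow> 'x" and f :: "'k::finite \<Rightarrow> 'x \<Rightarrow> real" and kstar :: 'k
  assumes incr_iid: "iid_seq M borel (centered_incr M X f)"
    and score_integrable: "\<And>k. integrable M (\<lambda>\<omega>. f k (X 1 \<omega>))"
    and best: "\<And>k. score_mean M X f k \<le> score_mean M X f kstar"
begin

abbreviation "Y \<equiv> centered_incr M X f"
abbreviation "S \<equiv> centered_walk M X f"
abbreviation "R \<equiv> drifted_walk M X f kstar"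
abbreviation "\<mu> \<equiv> score_mean M X f"
abbreviation "\<Delta> \<equiv> gap M X f kstar"
abbreviation "\<phi> \<equiv> selection_premium (incr_law M X f) \<Delta>"

lemma indep_incr: "indep_vars (\<lambda>_. borel) Y {1..}"
  using incr_iid by (simp add: iid_seq_def)

lemma distr_incr: "i \<ge> 1 \<Longrightarrow> distr M borel (Y i) = incr_law M X f"
  using incr_iid unfolding iid_seq_def incr_law_def by blast

lemma incr_measurable: "i \<ge> 1 \<Longrightarrow> Y i \<in> borel_measurable M"
  using indep_incr by (auto simp: indep_vars_def)

lemma incr_coord_first:
  "integrable M (\<lambda>\<omega>. Y 1 \<omega> $ k)" "expectation (\<lambda>\<omega>. Y 1 \<omega> $ k) = 0"
  using score_integrable[of k] by (auto simp: centered_incr_def score_mean_def prob_space)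

lemma incr_coord:
  assumes "i \<ge> 1"
  shows "integrable M (\<lambda>\<omega>. Y i \<omega> $ k)" and "expectation (\<lambda>\<omega>. Y i \<omega> $ k) = 0"
proof -
  have m: "(\<lambda>y :: real ^ 'k. y $ k) \<in> borel_measurable borel" by measurable
  have d: "distr M borel (Y i) = distr M borel (Y 1)"
    unfolding distr_incr[OF assms] distr_incr[OF order_refl] ..
  show "integrable M (\<lambda>\<omega>. Y i \<omega> $ k)" "expectation (\<lambda>\<omega>. Y i \<omega> $ k) = 0"
    using integrable_distr_eq[OF incr_measurable[OF assms] m] integral_distr[OF incr_measurable[OF assms] m]
      integrable_distr_eq[OF incr_measurable[of 1] m] integral_distr[OF incr_measurable[of 1] m]
      incr_coord_first[of k] d by auto
qed

lemma walk_coord: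
  shows "integrable M (\<lambda>\<omega>. S n \<omega> $ k)" and "expectation (\<lambda>\<omega>. S n \<omega> $ k) = 0"
  using incr_coord by (auto simp: centered_walk_def)

lemma gap_nonneg: "\<Delta> $ k \<ge> 0"
  using best by (simp add: gap_def)

lemma drifted_coord: "R n \<omega> $ k = S n \<omega> $ k - real n * \<Delta> $ k"
  by (simp add: drifted_walk_def)

lemma drifted_coord_le: "R n \<omega> $ k \<le> S n \<omega> $ k"
  using gap_nonneg[of k] by (simp add: drifted_coord)

text \<open>The best index has gap zero, so this coordinate carries no drift and keeps mean zero.
  The lower bound on the expected maximum rests on it.\<close>

lemma drifted_coord_best: "R n \<omega> $ kstar = S n \<omega> $ kstar"
  by (simp add: drifted_coord gap_def)

lemma drifted_Suc: "R (Suc n) \<omega> = R n \<omega> + Y (Suc n) \<omega> - \<Delta>"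
  by (simp add: drifted_walk_def centered_walk_def algebra_simps)

lemma drifted_integrable: "integrable M (\<lambda>\<omega>. R n \<omega> $ k)"
  using walk_coord by (simp add: drifted_coord)

lemma cum_score_coord: "cum_score X f n \<omega> $ k = S n \<omega> $ k + real n * \<mu> k"
  by (simp add: cum_score_def centered_walk_def centered_incr_def sum_subtractf)

text \<open>The shift is the same for all \<open>k\<close>: the gap in \<open>R\<close> absorbs the
  differences between the means. Hence the cumulative scores and \<open>R\<close> have the same
  maximizers.\<close>

lemma cum_score_drifted: "cum_score X f n \<omega> $ k = R n \<omega> $ k + real n * \<mu> kstar"
  by (simp add: cum_score_coord drifted_coord gap_def algebra_simps)

lemma max_coord_cum_score:
  "max_coord (cum_score X f n \<omega>) = max_coord (R n \<omega>) + real n * \<mu> kstar"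
proof -
  have "cum_score X f n \<omega> = (\<chi> k. R n \<omega> $ k + real n * \<mu> kstar)"
    by (simp add: vec_eq_iff cum_score_drifted)
  then show ?thesis by (simp add: max_coord_add_const)
qed

section \<open>Expected growth of the maximum\<close>

lemma max_drifted_integrable: "integrable M (\<lambda>\<omega>. max_coord (R n \<omega>))"
  by (intro integrable_max_coord drifted_integrable)

lemma premium_integrable: "integrable (incr_law M X f) (\<lambda>y. max_coord (u + y - \<Delta>))"
proof -
  have "integrable M (\<lambda>\<omega>. max_coord (u + Y 1 \<omega> - \<Delta>))"
    using incr_coord_first by (intro integrable_max_coord) simp
  then show ?thesis
    unfolding incr_law_def using incr_measurable[of 1] by (subst integrable_distr_eq) auto
qed

lemma indep_drifted_incr: "indep_var borel (R n) borel (Y (Suc n))"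
proof -
  have "indep_var borel (\<lambda>\<omega>. \<Sum>i\<in>{1..n}. Y i \<omega>) borel (Y (Suc n))"
    by (intro indep_var_sum_euclidean indep_vars_subset[OF indep_incr]) auto
  then have "indep_var borel ((\<lambda>s. s - real n *\<^sub>R \<Delta>) \<circ> (\<lambda>\<omega>. \<Sum>i\<in>{1..n}. Y i \<omega>))
      borel ((\<lambda>y. y) \<circ> Y (Suc n))"
    by (rule indep_var_compose) simp_all
  then show ?thesis
    by (simp only: comp_def drifted_walk_def[abs_def] centered_walk_def)
qed

text \<open>The new increment is independent of \<open>R n\<close> and has law
  \<open>incr_law M X f\<close>. Integrating it out with \<open>R n\<close> held fixed leaves the
  first term of the premium at \<open>R n\<close>; the subtracted term is the old maximum.\<close>

lemma expected_increase:
  shows "integrable M (\<lambda>\<omega>. \<phi> (R n \<omega>))"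
    and "expectation (\<lambda>\<omega>. max_coord (R (Suc n) \<omega>))
       = expectation (\<lambda>\<omega>. max_coord (R n \<omega>)) + expectation (\<lambda>\<omega>. \<phi> (R n \<omega>))"
proof -
  let ?g = "\<lambda>(u, y). max_coord (u + y - \<Delta>)"
  let ?h = "\<lambda>\<omega>. \<integral>y. max_coord (R n \<omega> + y - \<Delta>) \<partial>incr_law M X f"
  have g: "?g \<in> borel_measurable (borel \<Otimes>\<^sub>M borel)" by measurable
  have int: "integrable M (\<lambda>\<omega>. ?g (R n \<omega>, Y (Suc n) \<omega>))"
    using max_drifted_integrable[of "Suc n"] by (simp add: drifted_Suc)
  have h: "integrable M ?h" "expectation (\<lambda>\<omega>. max_coord (R (Suc n) \<omega>)) = expectation ?h"
    using indep_var_fubini[OF indep_drifted_incr g int] distr_incr[of "Suc n"]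
    by (simp_all add: drifted_Suc)
  show "integrable M (\<lambda>\<omega>. \<phi> (R n \<omega>))"
    using h(1) max_drifted_integrable by (simp add: selection_premium_def)
  show "expectation (\<lambda>\<omega>. max_coord (R (Suc n) \<omega>))
       = expectation (\<lambda>\<omega>. max_coord (R n \<omega>)) + expectation (\<lambda>\<omega>. \<phi> (R n \<omega>))"
    using h max_drifted_integrable by (simp add: selection_premium_def)
qed

text \<open>The one-step increases telescope from \<open>R 0 = 0\<close>, whose maximum is 0. Step
  \<open>i\<close> starts from \<open>R (i - 1)\<close>, where the natural subtraction is exact
  since \<open>i \<ge> 1\<close>.\<close>

lemma expected_max_drifted:
  "expectation (\<lambda>\<omega>. max_coord (R n \<omega>)) = (\<Sum>i=1..n. expectation (\<lambda>\<omega>. \<phi> (R (i - 1) \<omega>)))"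
proof (induction n)
  case 0
  then show ?case
    by (simp add: drifted_walk_def centered_walk_def max_coord_zero)
next
  case (Suc n)
  then show ?case by (simp add: expected_increase(2))
qed

lemma expected_max_drifted_nonneg: "0 \<le> expectation (\<lambda>\<omega>. max_coord (R n \<omega>))"
proof -
  have "expectation (\<lambda>\<omega>. S n \<omega> $ kstar) \<le> expectation (\<lambda>\<omega>. max_coord (R n \<omega>))"
    using coord_le_max_coord[of "R n _" kstar]
    by (intro integral_mono walk_coord max_drifted_integrable) (simp add: drifted_coord_best)
  then show ?thesis by (simp add: walk_coord)
qed

section \<open>Sublinear growth of the expected maximum\<close>

lemma expected_abs_walk_tendsto: "(\<lambda>n. expectation (\<lambda>\<omega>. \<bar>S n \<omega> $ k\<bar>) / real n) \<longlonglongrightarrow> 0"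
proof -
  have m: "(\<lambda>y :: real ^ 'k. y $ k) \<in> borel_measurable borel" by measurable
  have "indep_vars (\<lambda>_. borel) (\<lambda>i \<omega>. Y i \<omega> $ k) {1..}"
    by (rule indep_vars_compose2[OF indep_incr m])
  moreover have "distr M borel (\<lambda>\<omega>. Y i \<omega> $ k) = distr M borel (\<lambda>\<omega>. Y 1 \<omega> $ k)" if "i \<ge> 1" for i
    using distr_distr[OF m incr_measurable[OF that]] distr_distr[OF m incr_measurable[of 1]]
      distr_incr[OF that] distr_incr[of 1] by (simp add: comp_def)
  ultimately have "(\<lambda>n. expectation (\<lambda>\<omega>. \<bar>\<Sum>i=1..n. Y i \<omega> $ k\<bar>) / real n) \<longlonglongrightarrow> 0"
    by (intro L1_weak_law_of_large_numbers incr_coord_first)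
  then show ?thesis
    by (simp add: centered_walk_def)
qed

lemma expected_max_drifted_tendsto:
  "(\<lambda>n. 1 / real n * expectation (\<lambda>\<omega>. max_coord (R n \<omega>))) \<longlonglongrightarrow> 0"
proof (rule tendsto_sandwich[where f="\<lambda>_. 0"])
  have bound: "expectation (\<lambda>\<omega>. max_coord (R n \<omega>)) \<le> (\<Sum>k\<in>UNIV. expectation (\<lambda>\<omega>. \<bar>S n \<omega> $ k\<bar>))" for n
  proof -
    have "expectation (\<lambda>\<omega>. max_coord (R n \<omega>)) \<le> expectation (\<lambda>\<omega>. \<Sum>k\<in>UNIV. \<bar>S n \<omega> $ k\<bar>)"
    proof (intro integral_mono max_drifted_integrable)
      show "max_coord (R n \<omega>) \<le> (\<Sum>k\<in>UNIV. \<bar>S n \<omega> $ k\<bar>)" for \<omega>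
        using max_coord_mono[of "R n \<omega>" "S n \<omega>"] drifted_coord_le abs_max_coord_le[of "S n \<omega>"]
        by fastforce
    qed (use walk_coord in auto)
    then show ?thesis using walk_coord by simp
  qed
  \<comment> \<open>The bound holds for every \<open>n\<close>; at \<open>n = 0\<close> division by
    zero makes both sides 0.\<close>
  show "eventually (\<lambda>n. 1 / real n * expectation (\<lambda>\<omega>. max_coord (R n \<omega>))
      \<le> (\<Sum>k\<in>UNIV. expectation (\<lambda>\<omega>. \<bar>S n \<omega> $ k\<bar>) / real n)) sequentially"
    using bound by (simp add: sum_divide_distrib[symmetric] divide_right_mono)
  show "(\<lambda>n. \<Sum>k\<in>UNIV. expectation (\<lambda>\<omega>. \<bar>S n \<omega> $ k\<bar>) / real n) \<longlonglongrightarrow> 0"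
    by (intro tendsto_null_sum expected_abs_walk_tendsto)
  show "eventually (\<lambda>n. 0 \<le> 1 / real n * expectation (\<lambda>\<omega>. max_coord (R n \<omega>))) sequentially"
    using expected_max_drifted_nonneg by simp
qed simp

section \<open>The selected index\<close>

context
  fixes n :: nat and k :: "'a \<Rightarrow> 'k"
  assumes sel_measurable: "k \<in> measurable M (count_space UNIV)"
    and sel: "\<And>\<omega>. \<omega> \<in> space M \<Longrightarrow> is_arg_max (\<lambda>j. cum_score X f n \<omega> $ j) (\<lambda>_. True) (k \<omega>)"
begin

lemma selected_walk_integrable: "integrable M (\<lambda>\<omega>. S n \<omega> $ k \<omega>)"
proof (rule Bochner_Integration.integrable_bound)
  show "integrable M (\<lambda>\<omega>. \<Sum>j\<in>UNIV. \<bar>S n \<omega> $ j\<bar>)"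
    using walk_coord by auto
  show "(\<lambda>\<omega>. S n \<omega> $ k \<omega>) \<in> borel_measurable M"
    \<comment> \<open>A random coordinate is measurable because the index takes only finitely many
      values.\<close>
    by (rule measurable_compose_countable'[where f="\<lambda>j \<omega>. S n \<omega> $ j" and I=UNIV, OF _ sel_measurable])
      (use walk_coord in \<open>auto intro: countable_finite\<close>)
qed (use abs_coord_le_sum in \<open>auto intro!: AE_I2\<close>)

text \<open>The selected index also maximizes \<open>R n\<close>, and removing the nonnegative drift
  can only raise that coordinate. So the selected coordinate of \<open>S n\<close> lies above
  \<open>max_coord (R n)\<close>, whose expectation is nonnegative.\<close>

lemma selected_walk_nonneg: "0 \<le> expectation (\<lambda>\<omega>. S n \<omega> $ k \<omega>)"
proof -
  have "expectation (\<lambda>\<omega>. max_coord (R n \<omega>)) \<le> expectation (\<lambda>\<omega>. S n \<omega> $ k \<omega>)"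
  proof (intro integral_mono max_drifted_integrable selected_walk_integrable)
    fix \<omega> assume "\<omega> \<in> space M"
    then have "R n \<omega> $ j \<le> R n \<omega> $ k \<omega>" for j
      using sel[of \<omega>] by (auto simp: is_arg_max_def cum_score_drifted not_less)
    then have "max_coord (R n \<omega>) = R n \<omega> $ k \<omega>"
      by (rule max_coord_eqI)
    then show "max_coord (R n \<omega>) \<le> S n \<omega> $ k \<omega>"
      using drifted_coord_le by simp
  qed
  then show ?thesis using expected_max_drifted_nonneg[of n] by simp
qed

end

end

theorem theorem4p3:
  fixes M :: "'a measure" and N :: "'x measure"
    and X :: "nat \<Rightarrow> 'a \<Rightarrow> 'x"
    and f :: "'k::finite \<Rightarrow> 'x \<Rightarrow> real"
    and kstar :: 'k and khat :: "nat \<Rightarrow> 'a \<Rightarrow> 'k"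
  assumes M: "prob_space M"
    and X_iid: "iid_seq M N X"
    and f_meas: "\<And>k. f k \<in> borel_measurable N"
    and f_mean: "\<And>k. integrable M (\<lambda>\<omega>. f k (X 1 \<omega>))"
    and A1_iid: "iid_seq M borel (centered_incr M X f)"
    and A1_indep: "\<And>i. i \<ge> 1 \<Longrightarrow>
          rv_indep_of_alg M borel (centered_incr M X f i) (past_alg M N X (i - 1))"
    and A3: "integrable M (\<lambda>\<omega>. MAX k. \<bar>centered_incr M X f 1 \<omega> $ k\<bar>)"
    and kstar: "is_arg_max (score_mean M X f) (\<lambda>_. True) kstar"
    and khat_meas: "\<And>n. n \<ge> 1 \<Longrightarrow> khat n \<in> measurable M (count_space UNIV)"
    and khat: "\<And>n \<omega>. n \<ge> 1 \<Longrightarrow> \<omega> \<in> space M \<Longrightarrow>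
          is_arg_max (\<lambda>k. cum_score X f n \<omega> $ k) (\<lambda>_. True) (khat n \<omega>)"
  shows
    \<comment> \<open>the first conjunct asserts the existence of the expectations in the definition of the premium and in (a)--(d)\<close>
    "((\<forall>u. integrable (incr_law M X f) (\<lambda>y. max_coord (u + y - gap M X f kstar))) \<and>
     (\<forall>n\<ge>1.
        integrable M (\<lambda>\<omega>. max_coord (cum_score X f n \<omega>)) \<and>
        integrable M (\<lambda>\<omega>. max_coord (drifted_walk M X f kstar n \<omega>)) \<and>
        integrable M (\<lambda>\<omega>. max_coord (centered_walk M X f n \<omega>)) \<and>
        integrable M (\<lambda>\<omega>. centered_walk M X f n \<omega> $ khat n \<omega>) \<and>
        integrable M (\<lambda>\<omega>. cum_score X f n \<omega> $ khat n \<omega> / real n - score_mean M X f (khat n \<omega>)) \<and>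
        (\<forall>i\<in>{1..n}. integrable M (\<lambda>\<omega>.
           selection_premium (incr_law M X f) (gap M X f kstar) (drifted_walk M X f kstar (i - 1) \<omega>)))))
     \<and>
    (\<forall>n\<ge>1.
       (\<integral>\<omega>. max_coord (cum_score X f n \<omega>) \<partial>M) =
         real n * score_mean M X f kstar +
         (\<Sum>i=1..n. \<integral>\<omega>. selection_premium (incr_law M X f) (gap M X f kstar)
                            (drifted_walk M X f kstar (i - 1) \<omega>) \<partial>M) \<and>
       (\<integral>\<omega>. max_coord (drifted_walk M X f kstar n \<omega>) \<partial>M) =
         (\<Sum>i=1..n. \<integral>\<omega>. selection_premium (incr_law M X f) (gap M X f kstar)
                            (drifted_walk M X f kstar (i - 1) \<omega>) \<partial>M))
     \<and>
    (\<forall>n\<ge>1.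
       (\<integral>\<omega>. (cum_score X f n \<omega> $ khat n \<omega> / real n - score_mean M X f (khat n \<omega>)) \<partial>M) =
         1 / real n * (\<integral>\<omega>. centered_walk M X f n \<omega> $ khat n \<omega> \<partial>M) \<and>
       1 / real n * (\<integral>\<omega>. centered_walk M X f n \<omega> $ khat n \<omega> \<partial>M) \<ge> 0)
     \<and>
    (\<forall>n\<ge>1.
       0 \<le> (\<integral>\<omega>. max_coord (drifted_walk M X f kstar n \<omega>) \<partial>M) \<and>
       (\<integral>\<omega>. max_coord (drifted_walk M X f kstar n \<omega>) \<partial>M)
         \<le> (\<integral>\<omega>. max_coord (centered_walk M X f n \<omega>) \<partial>M))
     \<and>
    ((\<exists>!k. is_arg_max (score_mean M X f) (\<lambda>_. True) k) \<longrightarrow>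
       (\<lambda>n. 1 / real n * (\<integral>\<omega>. max_coord (drifted_walk M X f kstar n \<omega>) \<partial>M)) \<longlonglongrightarrow> 0)"
proof -
  interpret prob_space M by (rule M)
  interpret score_walk M X f kstar
    using A1_iid f_mean kstar by unfold_locales (auto simp: is_arg_max_def not_less)
  \<comment> \<open>The identity holds pointwise for each index, so the random index
    \<open>khat n \<omega>\<close> can be substituted before integrating.\<close>
  have bias: "cum_score X f n \<omega> $ k / real n - \<mu> k = 1 / real n * S n \<omega> $ k" if "n \<ge> 1" for n \<omega> k
    using that by (simp add: cum_score_coord field_simps)
  have selected: "integrable M (\<lambda>\<omega>. S n \<omega> $ khat n \<omega>)"
    "0 \<le> expectation (\<lambda>\<omega>. S n \<omega> $ khat n \<omega>)" if "n \<ge> 1" for n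
    using selected_walk_integrable[OF khat_meas khat] selected_walk_nonneg[OF khat_meas khat] that
    by auto
  have walk_max: "integrable M (\<lambda>\<omega>. max_coord (S n \<omega>))" for n
    by (intro integrable_max_coord walk_coord)
  have cum_max: "integrable M (\<lambda>\<omega>. max_coord (cum_score X f n \<omega>))"
    "expectation (\<lambda>\<omega>. max_coord (cum_score X f n \<omega>))
       = real n * \<mu> kstar + expectation (\<lambda>\<omega>. max_coord (R n \<omega>))" for n
    using max_drifted_integrable by (simp_all add: max_coord_cum_score prob_space)
  have drift_le: "expectation (\<lambda>\<omega>. max_coord (R n \<omega>)) \<le> expectation (\<lambda>\<omega>. max_coord (S n \<omega>))" for n
    by (intro integral_mono max_drifted_integrable walk_max max_coord_mono drifted_coord_le)
  show ?thesis
    using selected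
    by (intro conjI allI ballI impI premium_integrable cum_max(1) max_drifted_integrable walk_max
        expected_increase(1) expected_max_drifted expected_max_drifted_nonneg drift_le
        expected_max_drifted_tendsto)
      (simp_all add: bias cum_max(2) expected_max_drifted)
qed

end
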